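(* Let $L\ge 1$ and let $n_0,\dots,n_L\ge 1$ be integers. Let $\mathbf{W}=\{\mathbf{W}^{(1)},\dots,\mathbf{W}^{(L)}\}$ and $\hat{\mathbf{W}}=\{\hat{\mathbf{W}}^{(1)},\dots,\hat{\mathbf{W}}^{(L)}\}$ be two collections of real matrices with $\mathbf{W}^{(l)},\hat{\mathbf{W}}^{(l)}\in\mathbb{R}^{n_l\times n_{l-1}}$, and let $\tau^{(1)},\dots,\tau^{(L)}$ be real numbers. Let $\sigma$ be an activation function (a map sending each $\mathbb{R}^{n}$ to itself) and, for $\mathbf{x}\in\mathbb{R}^{n_0}$, let $$f(\mathbf{x},\mathbf{W})=\mathbf{W}^{(L)}\sigma\Big(\mathbf{W}^{(L-1)}\sigma\big(\cdots\sigma(\mathbf{W}^{(1)}\mathbf{x})\big)\Big)$$ be the output of the $L$-layer fully connected network with weights $\mathbf{W}$, and similarly $f(\mathbf{x},\hat{\mathbf{W}})$ with weights $\hat{\mathbf{W}}$. Assume: 1. (normalized input) $\|\mathbf{x}\|_1^2\le 1$; 2. (activation smoothness) $\sigma$ is $1$-Lipschitz in the $\ell_1$ norm, i.e. $\|\sigma(\mathbf{u})-\sigma(\mathbf{v})\|_1\le\|\mathbf{u}-\mathbf{v}\|_1$ for all vectors $\mathbf{u},\mathbf{v}$ of the same dimension, and $\sigma(0)=0$; 3. (bounded quantization error) $\|\mathbf{W}^{(l)}-\hat{\mathbf{W}}^{(l)}\|_1\le\tau^{(l)}$ for every $l=1,\dots,L$. Then $$\|f(\mathbf{x},\mathbf{W})-f(\mathbf{x},\hat{\mathbf{W}})\|_1\le\sum_{l=1}^{L}A^{(l)}\,\|\mathbf{W}^{(l)}-\hat{\mathbf{W}}^{(l)}\|_1,$$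 where $$A^{(l)}=\prod_{j=1}^{l-1}\|\mathbf{W}^{(j)}\|_1\prod_{k=l+1}^{L}\big(\|\mathbf{W}^{(k)}\|_1+\tau^{(k)}\big).$$
   Context: For a vector $\mathbf{u}$, $\|\mathbf{u}\|_1=\sum_i|u_i|$. For a matrix $\mathbf{M}$, $\|\mathbf{M}\|_1=\sum_{i,j}|M_{ij}|$ is the entrywise $\ell_1$ norm. Empty products equal $1$. The matrices $\mathbf{W}^{(l)}$ are the original layer weights and $\hat{\mathbf{W}}^{(l)}$ are the quantized layer weights. *)

theory Defs
  imports Complex_Main "Jordan_Normal_Form.Matrix"
begin

definition vec_l1 :: "real vec \<Rightarrow> real" where
  "vec_l1 u = (\<Sum>i<dim_vec u. \<bar>u $ i\<bar>)"

text \<open>Entrywise norm, not the operator norm induced by the vector norm above.\<close>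

definition mat_l1 :: "real mat \<Rightarrow> real" where
  "mat_l1 M = (\<Sum>i<dim_row M. \<Sum>j<dim_col M. \<bar>M $$ (i, j)\<bar>)"

text \<open>The layers are numbered from 1. The activation is applied between consecutive layers,
  so neither the input nor the output of the last layer is activated. The value for depth 0
  is a convention only.\<close>

fun network :: "(real vec \<Rightarrow> real vec) \<Rightarrow> (nat \<Rightarrow> real mat) \<Rightarrow> nat \<Rightarrow> real vec \<Rightarrow> real vec" where
  "network \<sigma> W 0 x = x"
| "network \<sigma> W (Suc 0) x = W 1 *\<^sub>v x"
| "network \<sigma> W (Suc (Suc l)) x = W (Suc (Suc l)) *\<^sub>v \<sigma> (network \<sigma> W (Suc l) x)"

end

(* Splitting W a - W' a' = (W - W') a + W' (a - a') at the outermost layer gives the recursion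
   e (l+1) <= |W (l+1) - W' (l+1)| * |a l| + (|W (l+1)| + tau (l+1)) * e l for the error e l of the
   first l layers, since |W'| <= |W| + tau. The activations a l of the original network are bounded
   by the product of the weight norms, and unrolling the recursion yields the sum. *)

theory Submission
  imports Defs
begin

lemma vec_l1_nonneg: "0 \<le> vec_l1 u"
  by (simp add: vec_l1_def sum_nonneg)

lemma mat_l1_nonneg: "0 \<le> mat_l1 M"
  by (simp add: mat_l1_def sum_nonneg)

lemma vec_l1_triangle:
  assumes "u \<in> carrier_vec m" "v \<in> carrier_vec m"
  shows "vec_l1 (u + v) \<le> vec_l1 u + vec_l1 v"
  using assms by (auto simp: vec_l1_def simp flip: sum.distrib intro!: sum_mono)

lemma mat_l1_triangle:
  assumes "A \<in> carrier_mat p q" "B \<in> carrier_mat p q"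
  shows "mat_l1 (A + B) \<le> mat_l1 A + mat_l1 B"
  using assms by (auto simp: mat_l1_def simp flip: sum.distrib intro!: sum_mono)

lemma mat_l1_minus_commute:
  assumes "A \<in> carrier_mat p q" "B \<in> carrier_mat p q"
  shows "mat_l1 (A - B) = mat_l1 (B - A)"
  using assms by (auto simp: mat_l1_def abs_minus_commute intro!: sum.cong)

text \<open>Triangle inequality for \<open>B = A + (B - A)\<close>. It eliminates the norm of the
  quantized weights, which does not occur in the final bound.\<close>

lemma mat_l1_le_add_diff:
  assumes A: "A \<in> carrier_mat p q" and B: "B \<in> carrier_mat p q"
  shows "mat_l1 B \<le> mat_l1 A + mat_l1 (A - B)"
proof -
  have "B = A + (B - A)"
    using A B by (intro eq_matI) auto
  then have "mat_l1 B \<le> mat_l1 A + mat_l1 (B - A)"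
    using mat_l1_triangle[OF A, of "B - A"] B A by (metis minus_carrier_mat)
  then show ?thesis
    by (simp add: mat_l1_minus_commute[OF A B])
qed

text \<open>Each coordinate of \<open>u\<close> is at most \<open>vec_l1 u\<close> in absolute
  value, so every entry of \<open>M\<close> can be charged with the whole norm of \<open>u\<close>.
  Thus the entrywise norm dominates the induced operator norm.\<close>

lemma vec_l1_mult_mat_vec:
  assumes M: "M \<in> carrier_mat p q" and u: "u \<in> carrier_vec q"
  shows "vec_l1 (M *\<^sub>v u) \<le> mat_l1 M * vec_l1 u"
proof -
  have coord: "\<bar>u $ j\<bar> \<le> vec_l1 u" if "j < q" for j
    unfolding vec_l1_def using that u by (intro member_le_sum) auto
  have "vec_l1 (M *\<^sub>v u) = (\<Sum>i<p. \<bar>\<Sum>j<q. M $$ (i, j) * u $ j\<bar>)"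
    using M u by (simp add: vec_l1_def scalar_prod_def lessThan_atLeast0)
  also have "\<dots> \<le> (\<Sum>i<p. \<Sum>j<q. \<bar>M $$ (i, j)\<bar> * vec_l1 u)"
    by (intro sum_mono order_trans[OF sum_abs])
      (auto simp: abs_mult intro!: mult_left_mono coord)
  also have "\<dots> = mat_l1 M * vec_l1 u"
    using M by (simp add: mat_l1_def sum_distrib_right)
  finally show ?thesis .
qed

text \<open>One layer of the error recursion. The mixed term is chosen so that \<open>A - B\<close>
  acts on \<open>u\<close>, the original activation; hence no bound on the norm of \<open>v\<close>
  is required.\<close>

lemma vec_l1_mult_mat_vec_diff:
  assumes A: "A \<in> carrier_mat p q" and B: "B \<in> carrier_mat p q"
    and u: "u \<in> carrier_vec q" and v: "v \<in> carrier_vec q"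
  shows "vec_l1 (A *\<^sub>v u - B *\<^sub>v v)
    \<le> mat_l1 (A - B) * vec_l1 u + (mat_l1 A + mat_l1 (A - B)) * vec_l1 (u - v)"
proof -
  have "A *\<^sub>v u - B *\<^sub>v v = (A - B) *\<^sub>v u + B *\<^sub>v (u - v)"
    using A B u v
    by (intro eq_vecI) (auto simp: minus_mult_distrib_mat_vec mult_minus_distrib_mat_vec)
  then have "vec_l1 (A *\<^sub>v u - B *\<^sub>v v) \<le> vec_l1 ((A - B) *\<^sub>v u) + vec_l1 (B *\<^sub>v (u - v))"
    using mult_mat_vec_carrier[OF minus_carrier_mat[OF B, of A] u]
      mult_mat_vec_carrier[OF B minus_carrier_vec[OF u v]]
    by (simp add: vec_l1_triangle)
  also have "\<dots> \<le> mat_l1 (A - B) * vec_l1 u + mat_l1 B * vec_l1 (u - v)"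
    using vec_l1_mult_mat_vec[OF minus_carrier_mat[OF B, of A] u]
      vec_l1_mult_mat_vec[OF B minus_carrier_vec[OF u v]]
    by (rule add_mono)
  also have "\<dots> \<le> mat_l1 (A - B) * vec_l1 u + (mat_l1 A + mat_l1 (A - B)) * vec_l1 (u - v)"
    using mat_l1_le_add_diff[OF A B]
    by (intro add_left_mono mult_right_mono vec_l1_nonneg)
  finally show ?thesis .
qed

text \<open>Merges the two successor equations into one, with \<open>id\<close> standing in for the
  missing activation of the input, so that inductions can start at depth 0.\<close>

lemma network_Suc:
  "network \<sigma> W (Suc l) x = W (Suc l) *\<^sub>v (if l = 0 then id else \<sigma>) (network \<sigma> W l x)"
  by (cases l) auto

lemma network_carrier:
  assumes "\<And>i. 1 \<le> i \<Longrightarrow> i \<le> l \<Longrightarrow> W i \<in> carrier_mat (n i) (n (i - 1))"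
    and "x \<in> carrier_vec (n 0)"
  shows "network \<sigma> W l x \<in> carrier_vec (n l)"
proof (cases l)
  case (Suc k)
  \<comment> \<open>The output dimension is the row count of the outermost matrix alone, so a case
    distinction replaces induction.\<close>
  have "dim_row (W (Suc k)) = n (Suc k)"
    using carrier_matD(1)[OF assms(1)[of "Suc k"]] Suc by simp
  then show ?thesis
    unfolding Suc network_Suc by (intro carrier_vecI) simp
qed (use assms(2) in simp)

text \<open>Each layer scales the norm by at most \<open>mat_l1 (W i)\<close>, and the activation
  does not increase it.\<close>

lemma vec_l1_network_le:
  assumes W: "\<And>i. 1 \<le> i \<Longrightarrow> i \<le> l \<Longrightarrow> W i \<in> carrier_mat (n i) (n (i - 1))"
    and x: "x \<in> carrier_vec (n 0)"
    and \<sigma>: "\<And>m u. u \<in> carrier_vec m \<Longrightarrow> \<sigma> u \<in> carrier_vec m"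
    and \<sigma>_le: "\<And>u. vec_l1 (\<sigma> u) \<le> vec_l1 u"
  shows "vec_l1 (network \<sigma> W l x) \<le> (\<Prod>i = 1..l. mat_l1 (W i)) * vec_l1 x"
  using W
proof (induction l)
  case (Suc l)
  let ?h = "if l = 0 then id else \<sigma>" and ?y = "network \<sigma> W l x"
  have y: "?y \<in> carrier_vec (n l)"
    using Suc.prems x by (intro network_carrier) auto
  have "vec_l1 (network \<sigma> W (Suc l) x) \<le> mat_l1 (W (Suc l)) * vec_l1 (?h ?y)"
    unfolding network_Suc using Suc.prems[of "Suc l"] y \<sigma>[OF y]
    by (intro vec_l1_mult_mat_vec) auto
  also have "\<dots> \<le> mat_l1 (W (Suc l)) * vec_l1 ?y"
    using \<sigma>_le by (intro mult_left_mono mat_l1_nonneg) auto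
  also have "\<dots> \<le> mat_l1 (W (Suc l)) * ((\<Prod>i = 1..l. mat_l1 (W i)) * vec_l1 x)"
    using Suc.prems by (intro mult_left_mono mat_l1_nonneg Suc.IH) auto
  finally show ?case
    by (simp add: mult_ac)
qed simp

lemma vec_l1_network_diff_le:
  assumes W: "\<And>i. 1 \<le> i \<Longrightarrow> i \<le> l \<Longrightarrow> W i \<in> carrier_mat (n i) (n (i - 1))"
    and W': "\<And>i. 1 \<le> i \<Longrightarrow> i \<le> l \<Longrightarrow> W' i \<in> carrier_mat (n i) (n (i - 1))"
    and x: "x \<in> carrier_vec (n 0)" and x1: "vec_l1 x \<le> 1"
    and \<sigma>: "\<And>m u. u \<in> carrier_vec m \<Longrightarrow> \<sigma> u \<in> carrier_vec m"
    and lip: "\<And>m u v. u \<in> carrier_vec m \<Longrightarrow> v \<in> carrier_vec m \<Longrightarrow>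
      vec_l1 (\<sigma> u - \<sigma> v) \<le> vec_l1 (u - v)"
    and \<sigma>_le: "\<And>u. vec_l1 (\<sigma> u) \<le> vec_l1 u"
    and \<tau>: "\<And>i. 1 \<le> i \<Longrightarrow> i \<le> l \<Longrightarrow> mat_l1 (W i - W' i) \<le> \<tau> i"
  shows "vec_l1 (network \<sigma> W l x - network \<sigma> W' l x) \<le>
    (\<Sum>i = 1..l. ((\<Prod>j = 1..<i. mat_l1 (W j)) * (\<Prod>k = i + 1..l. mat_l1 (W k) + \<tau> k))
                 * mat_l1 (W i - W' i))"
  using W W' \<tau>
proof (induction l)
  case 0
  then show ?case
    by (simp add: vec_l1_def)
next
  case (Suc l)
  let ?h = "if l = 0 then id else \<sigma>"
  let ?y = "network \<sigma> W l x" and ?z = "network \<sigma> W' l x"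
  let ?w = "mat_l1 (W (Suc l))" and ?d = "mat_l1 (W (Suc l) - W' (Suc l))"
  let ?P = "\<lambda>i. \<Prod>j = 1..<i. mat_l1 (W j)" and ?Q = "\<lambda>i l. \<Prod>k = i + 1..l. mat_l1 (W k) + \<tau> k"
  let ?D = "\<lambda>i. mat_l1 (W i - W' i)"
  have y: "?y \<in> carrier_vec (n l)" and z: "?z \<in> carrier_vec (n l)"
    using Suc.prems x by (simp_all add: network_carrier)
  have "vec_l1 (?h ?y) \<le> vec_l1 ?y"
    using \<sigma>_le by simp
  also have "\<dots> \<le> (\<Prod>i = 1..l. mat_l1 (W i)) * vec_l1 x"
    using Suc.prems x \<sigma> \<sigma>_le by (intro vec_l1_network_le) auto
  \<comment> \<open>The half-open product \<open>?P (Suc l)\<close> runs over \<open>1..l\<close>;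
    the factor \<open>vec_l1 x\<close> is at most 1 and is dropped.\<close>
  also have "\<dots> \<le> ?P (Suc l)"
    using x1 by (auto simp: atLeastLessThanSuc_atLeastAtMost
        intro!: mult_left_le prod_nonneg mat_l1_nonneg)
  finally have hy: "vec_l1 (?h ?y) \<le> ?P (Suc l)" .
  have IH: "vec_l1 (?y - ?z) \<le> (\<Sum>i = 1..l. (?P i * ?Q i l) * ?D i)"
    using Suc.prems by (intro Suc.IH) auto
  have \<tau>: "?d \<le> \<tau> (Suc l)"
    using Suc.prems by simp
  \<comment> \<open>An equality for \<open>l = 0\<close>, where \<open>?h\<close> is
    \<open>id\<close>; otherwise the Lipschitz condition.\<close>
  have hyz: "vec_l1 (?h ?y - ?h ?z) \<le> vec_l1 (?y - ?z)"
    using lip[OF y z] by simp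
  have "vec_l1 (network \<sigma> W (Suc l) x - network \<sigma> W' (Suc l) x)
      \<le> ?d * vec_l1 (?h ?y) + (?w + ?d) * vec_l1 (?h ?y - ?h ?z)"
    unfolding network_Suc
    using Suc.prems(1)[of "Suc l"] Suc.prems(2)[of "Suc l"] y z \<sigma>[OF y] \<sigma>[OF z]
    by (intro vec_l1_mult_mat_vec_diff) auto
  \<comment> \<open>Only the second \<open>?d\<close> is relaxed to \<open>\<tau> (Suc l)\<close>.
    The first stays exact: it becomes the new summand \<open>i = Suc l\<close>, whose product
    \<open>?Q\<close> is empty.\<close>
  also have "\<dots> \<le> ?d * ?P (Suc l) + (?w + \<tau> (Suc l)) * (\<Sum>i = 1..l. (?P i * ?Q i l) * ?D i)"
  proof (intro add_mono mult_left_mono mult_mono)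
    \<comment> \<open>\<open>\<tau> (Suc l)\<close> is nonnegative because it bounds the norm
      \<open>?d\<close>.\<close>
    show "0 \<le> ?w + \<tau> (Suc l)"
      using \<tau> mat_l1_nonneg by (meson add_nonneg_nonneg order_trans)
  qed (use hy IH hyz \<tau> in \<open>simp_all add: mat_l1_nonneg vec_l1_nonneg\<close>)
  \<comment> \<open>The new factor is the one with \<open>k = Suc l\<close>, extending
    \<open>?Q i l\<close> to \<open>?Q i (Suc l)\<close> for every \<open>i \<le> l\<close>.\<close>
  also have "(?w + \<tau> (Suc l)) * (\<Sum>i = 1..l. (?P i * ?Q i l) * ?D i)
      = (\<Sum>i = 1..l. (?P i * ?Q i (Suc l)) * ?D i)"
    by (auto simp: sum_distrib_left mult_ac intro!: sum.cong)
  finally show ?case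
    by (simp add: mult_ac add_ac)
qed

theorem mainTheorem1:
  fixes L :: nat and n :: "nat \<Rightarrow> nat"
    and W W' :: "nat \<Rightarrow> real mat" and \<tau> :: "nat \<Rightarrow> real"
    and \<sigma> :: "real vec \<Rightarrow> real vec" and x :: "real vec"
  assumes "L \<ge> 1"
    and "\<And>l. l \<le> L \<Longrightarrow> n l \<ge> 1"
    and "\<And>l. 1 \<le> l \<Longrightarrow> l \<le> L \<Longrightarrow> W l \<in> carrier_mat (n l) (n (l - 1))"
    and "\<And>l. 1 \<le> l \<Longrightarrow> l \<le> L \<Longrightarrow> W' l \<in> carrier_mat (n l) (n (l - 1))"
    and "\<And>m u. u \<in> carrier_vec m \<Longrightarrow> \<sigma> u \<in> carrier_vec m"
    and "x \<in> carrier_vec (n 0)"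
    and "(vec_l1 x)\<^sup>2 \<le> 1"
    and "\<And>m u v. u \<in> carrier_vec m \<Longrightarrow> v \<in> carrier_vec m \<Longrightarrow>
           vec_l1 (\<sigma> u - \<sigma> v) \<le> vec_l1 (u - v)"
    and "\<And>m. \<sigma> (0\<^sub>v m) = 0\<^sub>v m"
    and "\<And>l. 1 \<le> l \<Longrightarrow> l \<le> L \<Longrightarrow> mat_l1 (W l - W' l) \<le> \<tau> l"
  shows "vec_l1 (network \<sigma> W L x - network \<sigma> W' L x) \<le>
    (\<Sum>l = 1..L. ((\<Prod>j = 1..<l. mat_l1 (W j)) * (\<Prod>k = l + 1..L. mat_l1 (W k) + \<tau> k))
                 * mat_l1 (W l - W' l))"
proof -
  have x1: "vec_l1 x \<le> 1"
    using assms(7) vec_l1_nonneg[of x] by (simp add: abs_square_le_1)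
  \<comment> \<open>The Lipschitz condition against the zero vector of the same dimension, which
    \<open>\<sigma>\<close> fixes.\<close>
  have \<sigma>_le: "vec_l1 (\<sigma> u) \<le> vec_l1 u" for u
  proof -
    let ?m = "dim_vec u"
    have u: "u \<in> carrier_vec ?m"
      by simp
    from assms(5)[OF u] have "\<sigma> u - \<sigma> (0\<^sub>v ?m) = \<sigma> u"
      unfolding assms(9) by (rule minus_zero_vec)
    with assms(8)[OF u zero_carrier_vec] show ?thesis
      by (simp only: minus_zero_vec[OF u])
  qed
  show ?thesis
    by (rule vec_l1_network_diff_le[where n = n and \<sigma> = \<sigma> and W = W and W' = W' and \<tau> = \<tau>])
      (fact assms(3) assms(4) assms(6) x1 assms(5) assms(8) \<sigma>_le assms(10))+
qed

end
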